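(* Let $X=\{0,1,\dots,6\}$ and let $\mathcal{B}$ consist of the 14 transitive triples $(0,4,2), (0,5,6), (1,3,0), (1,5,2), (2,0,1), (2,6,5), (3,1,6), (3,2,4), (4,3,5), (4,6,1), (5,0,3), (5,1,4), (6,2,3), (6,4,0)$. Then $(X,\mathcal{B})$ is a DTS$(7)$ that does not have a $7$-good sequencing.
   Context: A transitive triple is an ordered triple $(x,y,z)$ of distinct elements; it contains the directed edges $(x,y)$, $(x,z)$, $(y,z)$. A directed triple system of order $v$, DTS$(v)$, is a pair $(X,\mathcal{B})$ where $X$ is a set of $v$ points and $\mathcal{B}$ is a set of transitive triples of elements of $X$ such that every ordered pair $(a,b)$ of distinct points of $X$ occurs as a directed edge in exactly one triple of $\mathcal{B}$. A $v$-good sequencing of a DTS$(v)$ $(X,\mathcal{B})$ is a permutation $[x_1\, x_2\, \cdots\, x_v]$ of $X$ such that for no triple $(x,y,z)\in\mathcal{B}$ do we have $x=x_i$, $y=x_j$, $z=x_k$ with $i<j<k$. *)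

theory Defs
  imports Main
begin

type_synonym 'a triple = "'a \<times> 'a \<times> 'a"

definition transitive_triple_on :: "'a set \<Rightarrow> 'a triple \<Rightarrow> bool" where
  "transitive_triple_on X = (\<lambda>(x, y, z).
     x \<in> X \<and> y \<in> X \<and> z \<in> X \<and> x \<noteq> y \<and> x \<noteq> z \<and> y \<noteq> z)"

definition directed_edges :: "'a triple \<Rightarrow> ('a \<times> 'a) set" where
  "directed_edges = (\<lambda>(x, y, z). {(x, y), (x, z), (y, z)})"

definition directed_triple_system :: "nat \<Rightarrow> 'a set \<Rightarrow> 'a triple set \<Rightarrow> bool" where
  "directed_triple_system v X B \<longleftrightarrow>
     finite X \<and> card X = v \<and>
     (\<forall>t\<in>B. transitive_triple_on X t) \<and>
     (\<forall>a\<in>X. \<forall>b\<in>X. a \<noteq> b \<longrightarrow> (\<exists>!t. t \<in> B \<and> (a, b) \<in> directed_edges t))"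

text \<open>A permutation \<open>[x\<^sub>1 \<dots> x\<^sub>v]\<close> of \<open>X\<close> is a duplicate-free list of length \<open>v\<close> with
  underlying set \<open>X\<close>; list positions count from 0, so \<open>x\<^sub>i\<close> is \<open>xs ! (i - 1)\<close>.\<close>

definition good_sequencing :: "nat \<Rightarrow> 'a set \<Rightarrow> 'a triple set \<Rightarrow> 'a list \<Rightarrow> bool" where
  "good_sequencing v X B xs \<longleftrightarrow>
     length xs = v \<and> distinct xs \<and> set xs = X \<and>
     \<not> (\<exists>x y z i j k. (x, y, z) \<in> B \<and> i < j \<and> j < k \<and> k < v \<and>
          x = xs ! i \<and> y = xs ! j \<and> z = xs ! k)"

end

theory Submission
  imports Defs
begin

text \<open>In a good sequencing, whenever \<open>x\<close> precedes \<open>y\<close> in a triple \<open>(x, y, z)\<close>, so must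
  \<open>z\<close>. For the given system these 14 implications admit no linear order of the points.\<close>

text \<open>Trades the list for a position function \<open>p\<close>. It is injective because
  indexing \<open>xs\<close> undoes it.\<close>

lemma good_sequencing_positions:
  assumes "good_sequencing v X B xs"
  obtains p :: "'a \<Rightarrow> nat" where "inj_on p X"
    and "\<And>x y z. \<lbrakk>(x, y, z) \<in> B; x \<in> X; y \<in> X; z \<in> X; p x < p y\<rbrakk> \<Longrightarrow> p z \<le> p y"
proof -
  from assms have len: "length xs = v" and set: "set xs = X"
    and bad: "\<And>x y z i j k. \<lbrakk>(x, y, z) \<in> B; i < j; j < k; k < v;
      x = xs ! i; y = xs ! j; z = xs ! k\<rbrakk> \<Longrightarrow> False"
    unfolding good_sequencing_def by blast+
  have "\<forall>x\<in>X. \<exists>i<v. xs ! i = x"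
    using len set by (metis in_set_conv_nth)
  then obtain p where p: "\<And>x. x \<in> X \<Longrightarrow> p x < v" "\<And>x. x \<in> X \<Longrightarrow> xs ! p x = x"
    by metis
  show thesis
  proof
    show "inj_on p X"
      using p(2) by (metis inj_onI)
    \<comment> \<open>If \<open>p y < p z\<close>, then \<open>p x < p y < p z\<close> are positions
      below \<open>v\<close> at which \<open>xs\<close> contains the forbidden triple.\<close>
    show "p z \<le> p y" if "(x, y, z) \<in> B" "x \<in> X" "y \<in> X" "z \<in> X" "p x < p y" for x y z
      using bad[OF that(1,5)] p that(2-4) by (metis not_le)
  qed
qed

text \<open>Bounded quantifiers over an explicit finite set unfold into finite conjunctions and
  disjunctions, so the edge condition becomes a check by simplification.\<close>

lemma ex1_mem_iff: "(\<exists>!t. t \<in> B \<and> P t) \<longleftrightarrow> (\<exists>t\<in>B. P t \<and> (\<forall>s\<in>B. P s \<longrightarrow> s = t))"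
  by blast

text \<open>Compare \<open>c\<close> and \<open>e\<close>, using the implications and their
  contrapositives. If \<open>e < c\<close>, then in turn \<open>e < a\<close>, \<open>e < g\<close>,
  \<open>b < g\<close>, \<open>b < d\<close>, \<open>a < d\<close>, \<open>a < f\<close>,
  \<open>g < f\<close>, \<open>g < c\<close>, \<open>d < c\<close>; now \<open>e < d\<close> gives
  \<open>f < d\<close> and \<open>b < f\<close> gives \<open>c < f\<close>, a cycle on
  \<open>c\<close>, \<open>d\<close>, \<open>f\<close>. If \<open>c < e\<close>, then in turn
  \<open>c < d\<close>, \<open>c < g\<close>, \<open>f < g\<close>, \<open>f < a\<close>,
  \<open>d < a\<close>, \<open>d < b\<close>, \<open>g < b\<close>, \<open>g < e\<close>,
  \<open>a < e\<close>; now \<open>c < a\<close> gives \<open>b < a\<close> and \<open>f < b\<close>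
  gives \<open>e < b\<close>, a cycle on \<open>a\<close>, \<open>b\<close>,
  \<open>e\<close>.\<close>

lemma seven_points_no_order:
  fixes a b c d e f g :: "'a :: linorder"
  assumes "a < e \<Longrightarrow> c < e" "a < f \<Longrightarrow> g < f" "b < d \<Longrightarrow> a < d" "b < f \<Longrightarrow> c < f"
    and "c < a \<Longrightarrow> b < a" "c < g \<Longrightarrow> f < g" "d < b \<Longrightarrow> g < b" "d < c \<Longrightarrow> e < c"
    and "e < d \<Longrightarrow> f < d" "e < g \<Longrightarrow> b < g" "f < a \<Longrightarrow> d < a" "f < b \<Longrightarrow> e < b"
    and "g < c \<Longrightarrow> d < c" "g < e \<Longrightarrow> a < e"
    and distinct: "distinct [a, b, c, d, e, f, g]"
  shows False
  using assms(1-14) distinct[simplified] by (metis linorder_neqE less_trans less_irrefl)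

theorem theorem4p1:
  fixes X :: "nat set" and B :: "nat triple set"
  assumes "X = {0..6}"
    and "B = {(0,4,2), (0,5,6), (1,3,0), (1,5,2), (2,0,1), (2,6,5), (3,1,6),
              (3,2,4), (4,3,5), (4,6,1), (5,0,3), (5,1,4), (6,2,3), (6,4,0)}"
  shows "directed_triple_system 7 X B \<and> \<not> (\<exists>xs. good_sequencing 7 X B xs)"
proof
  have X: "X = {0, 1, 2, 3, 4, 5, 6}"
    unfolding assms(1) by auto
  show "directed_triple_system 7 X B"
    unfolding directed_triple_system_def transitive_triple_on_def directed_edges_def
      ex1_mem_iff X assms(2) by simp
  show "\<not> (\<exists>xs. good_sequencing 7 X B xs)"
  proof
    assume "\<exists>xs. good_sequencing 7 X B xs"
    then obtain p :: "nat \<Rightarrow> nat" where inj: "inj_on p X"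
      and le: "\<And>x y z. \<lbrakk>(x, y, z) \<in> B; x \<in> X; y \<in> X; z \<in> X; p x < p y\<rbrakk> \<Longrightarrow> p z \<le> p y"
      using good_sequencing_positions by metis
    \<comment> \<open>Injectivity of \<open>p\<close> makes the inequality strict, since
      \<open>y\<close> and \<open>z\<close> differ.\<close>
    have less: "p z < p y" if "(x, y, z) \<in> B" "y \<noteq> z" "x \<in> X" "y \<in> X" "z \<in> X" "p x < p y" for x y z
      using le[OF that(1,3-6)] inj_onD[OF inj, of z y] that(2,4,5) by fastforce
    \<comment> \<open>One implication per triple, in the order of \<open>B\<close>;
      \<open>p 0\<close> to \<open>p 6\<close> take the places of \<open>a\<close> to
      \<open>g\<close>.\<close>
    have "p 0 < p 4 \<Longrightarrow> p 2 < p 4" "p 0 < p 5 \<Longrightarrow> p 6 < p 5"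
      "p 1 < p 3 \<Longrightarrow> p 0 < p 3" "p 1 < p 5 \<Longrightarrow> p 2 < p 5"
      "p 2 < p 0 \<Longrightarrow> p 1 < p 0" "p 2 < p 6 \<Longrightarrow> p 5 < p 6"
      "p 3 < p 1 \<Longrightarrow> p 6 < p 1" "p 3 < p 2 \<Longrightarrow> p 4 < p 2"
      "p 4 < p 3 \<Longrightarrow> p 5 < p 3" "p 4 < p 6 \<Longrightarrow> p 1 < p 6"
      "p 5 < p 0 \<Longrightarrow> p 3 < p 0" "p 5 < p 1 \<Longrightarrow> p 4 < p 1"
      "p 6 < p 2 \<Longrightarrow> p 3 < p 2" "p 6 < p 4 \<Longrightarrow> p 0 < p 4"
      by (rule less; simp add: X assms(2))+
    moreover have "distinct [p 0, p 1, p 2, p 3, p 4, p 5, p 6]"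
      using inj unfolding X by simp
    ultimately show False
      by (rule seven_points_no_order)
  qed
qed

end
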